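(* Let $C\in\mathbb{S}_C$, $u^*\in\mathbb{R}^m$ and $v^*\in\mathbb{R}^n$ with $\|u^*\|_1=\|v^*\|_1=1$. Then $(C,u^*,v^* )\notin\mathcal{D}_{asym}$ if and only if both of the following hold: (1) $\mathbb{G}_1(C,u^*,v^* )$ is connected; (2) $\mathcal{I}_{00}^u(C,u^*,v^* )=\emptyset$ and $\mathcal{I}_{00}^v(C,u^*,v^* )=\emptyset$. Moreover, the closure $\overline{\mathcal{D}}_{asym}$ of $\mathcal{D}_{asym}$ is the set of all $(C,u^*,v^* )$ with $C\in\mathbb{S}_C$, $u^*\in\mathbb{R}^m$, $v^*\in\mathbb{R}^n$, $\|u^*\|_1=\|v^*\|_1=1$, such that $\mathbb{G}_1(C,u^*,v^* )$ is disconnected, or $\mathcal{I}_{00}^u(C,u^*,v^* )$ is not empty, or $\mathcal{I}_{00}^v(C,u^*,v^* )$ is not empty.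
   Context: $\mathbb{S}_C$: the set of matrices $C\in\mathbb{R}^{m\times n}$ (not assumed symmetric) with nonnegative entries and $\sum_{i,j}C_{ij}=1$. Let $h(u,v;C,u^*,v^* ):=\sum_{i\in[m],j\in[n]}C_{ij}(u_iv_j-u_i^*v_j^* )^2$ for $u\in\mathbb{R}^m$, $v\in\mathbb{R}^n$. Degenerate set: $\mathcal{D}_{asym}:=\{(C,u^*,v^* ): C\in\mathbb{S}_C,\ u^*\in\mathbb{R}^m,\ v^*\in\mathbb{R}^n,\ \|u^*\|_1=\|v^*\|_1=1,\ \exists u\in\mathbb{R}^m,v\in\mathbb{R}^n\text{ with }h(u,v;C,u^*,v^* )=0,\ uv^T\ne u^*(v^* )^T\}$. Graph notation: $\mathbb{G}(C,u^*,v^* )$ is the graph on node set $[m+n]$ with edge set $\mathbb{E}=\{\{i,j+m\}: i\in[m],j\in[n],C_{ij}>0\}$. $\mathcal{I}_1^u=\{i\in[m]:u_i^*\ne0\}$, $\mathcal{I}_0^u=[m]\setminus\mathcal{I}_1^u$, $\mathcal{I}_1^v=\{j+m: j\in[n],v_j^*\ne0\}$, $\mathcal{I}_0^v=\{m+1,\dots,m+n\}\setminus\mathcal{I}_1^v$. $\mathcal{I}_{00}^u$ is the set of $i\in\mathcal{I}_0^u$ not adjacent to any node of $\mathcal{I}_1^v$; $\mathcal{I}_{00}^v$ is the set of nodes in $\mathcal{I}_0^v$ not adjacent to any node of $\mathcal{I}_1^u$. $\mathbb{G}_1(C,u^*,v^* )$ is the subgraph induced by $\mathcal{I}_1^u\cup\mathcal{I}_1^v$.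 The closure is taken in $\mathbb{R}^{m\times n}\times\mathbb{R}^m\times\mathbb{R}^n$. *)

theory Defs
  imports "HOL-Analysis.Analysis" "Graph_Theory.Digraph_Component"
begin

text \<open>
  The index sets $[m]$ and $[n]$ are finite types; \<open>real ^ 'n ^ 'm\<close> is the space of
  $m \times n$ matrices, with \<open>C $ i $ j\<close> the entry in row \<open>i\<close> and column \<open>j\<close>.
\<close>

definition S_C :: "(real ^ 'n ^ 'm) set" where
  "S_C = {C. (\<forall>i j. 0 \<le> C $ i $ j) \<and> (\<Sum>i\<in>UNIV. \<Sum>j\<in>UNIV. C $ i $ j) = 1}"

definition l1norm :: "real ^ 'k \<Rightarrow> real" where
  "l1norm x = (\<Sum>i\<in>UNIV. \<bar>x $ i\<bar>)"

definition outer :: "real ^ 'm \<Rightarrow> real ^ 'n \<Rightarrow> real ^ 'n ^ 'm" where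
  "outer u v = (\<chi> i j. u $ i * v $ j)"

definition h :: "real ^ 'm \<Rightarrow> real ^ 'n \<Rightarrow> real ^ 'n ^ 'm \<Rightarrow> real ^ 'm \<Rightarrow> real ^ 'n \<Rightarrow> real" where
  "h u v C us vs = (\<Sum>i\<in>UNIV. \<Sum>j\<in>UNIV. C $ i $ j * (u $ i * v $ j - us $ i * vs $ j)\<^sup>2)"

definition D_asym :: "((real ^ 'n ^ 'm) \<times> (real ^ 'm) \<times> (real ^ 'n)) set" where
  "D_asym = {(C, us, vs). C \<in> S_C \<and> l1norm us = 1 \<and> l1norm vs = 1 \<and>
     (\<exists>u v. h u v C us vs = 0 \<and> outer u v \<noteq> outer us vs)}"

text \<open>
  The node set $[m+n]$ is the disjoint sum \<open>'m + 'n\<close>: \<open>Inl i\<close> is node $i$ and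
  \<open>Inr j\<close> is node $m + j$.
\<close>

definition edges :: "real ^ 'n ^ 'm \<Rightarrow> ('m + 'n) set set" where
  "edges C = {{Inl i, Inr j} | i j. C $ i $ j > 0}"

text \<open>
  An undirected graph is a symmetric digraph: each edge \<open>{x, y}\<close> is represented by
  the two arcs \<open>(x, y)\<close> and \<open>(y, x)\<close>.
\<close>

definition GG :: "real ^ 'n ^ 'm \<Rightarrow> ('m + 'n, ('m + 'n) \<times> ('m + 'n)) pre_digraph" where
  "GG C = with_proj \<lparr>pverts = UNIV, parcs = {(x, y). {x, y} \<in> edges C}\<rparr>"

definition I1u :: "real ^ 'm \<Rightarrow> ('m + 'n) set" where
  "I1u us = {Inl i | i. us $ i \<noteq> 0}"

definition I0u :: "real ^ 'm \<Rightarrow> ('m + 'n) set" where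
  "I0u us = range Inl - I1u us"

definition I1v :: "real ^ 'n \<Rightarrow> ('m + 'n) set" where
  "I1v vs = {Inr j | j. vs $ j \<noteq> 0}"

definition I0v :: "real ^ 'n \<Rightarrow> ('m + 'n) set" where
  "I0v vs = range Inr - I1v vs"

definition I00u :: "real ^ 'n ^ 'm \<Rightarrow> real ^ 'm \<Rightarrow> real ^ 'n \<Rightarrow> ('m + 'n) set" where
  "I00u C us vs = {x \<in> I0u us. \<not> (\<exists>y \<in> I1v vs. x \<rightarrow>\<^bsub>GG C\<^esub> y)}"

definition I00v :: "real ^ 'n ^ 'm \<Rightarrow> real ^ 'm \<Rightarrow> real ^ 'n \<Rightarrow> ('m + 'n) set" where
  "I00v C us vs = {y \<in> I0v vs. \<not> (\<exists>x \<in> I1u us. y \<rightarrow>\<^bsub>GG C\<^esub> x)}"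

definition GG1 :: "real ^ 'n ^ 'm \<Rightarrow> real ^ 'm \<Rightarrow> real ^ 'n
    \<Rightarrow> ('m + 'n, ('m + 'n) \<times> ('m + 'n)) pre_digraph" where
  "GG1 C us vs = GG C \<restriction> (I1u us \<union> I1v vs)"

text \<open>
  The qualified name distinguishes graph connectedness from the topological
  \<open>connected\<close>. The library counts the graph without nodes as not connected; this
  graph cannot occur as \<open>GG1\<close> when \<open>us\<close> and \<open>vs\<close> have 1-norm one.
\<close>

abbreviation graph_connected :: "('a, 'b) pre_digraph \<Rightarrow> bool" where
  "graph_connected \<equiv> Digraph_Component.connected"

lemma GG_adj: "Inl i \<rightarrow>\<^bsub>GG C\<^esub> Inr j \<longleftrightarrow> C $ i $ j > 0"
              "Inr j \<rightarrow>\<^bsub>GG C\<^esub> Inl i \<longleftrightarrow> C $ i $ j > 0"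
              "\<not> Inl i \<rightarrow>\<^bsub>GG C\<^esub> Inl i'"
              "\<not> Inr j \<rightarrow>\<^bsub>GG C\<^esub> Inr j'"
  by (auto simp: GG_def edges_def doubleton_eq_iff)

lemma GG_graph: "graph (GG (C :: real ^ 'n ^ 'm))"
proof -
  interpret pair_graph "\<lparr>pverts = (UNIV :: ('m + 'n) set), parcs = {(x, y). {x, y} \<in> edges C}\<rparr>"
    by unfold_locales
       (auto simp: symmetric_def edges_def insert_commute intro!: symI)
  show ?thesis unfolding GG_def by unfold_locales
qed

end

theory Submission
  imports Defs
begin

text \<open>
  On a connected \<open>\<G>\<^sub>1\<close> the equations \<open>u\<^sub>i v\<^sub>j = u\<^sup>*\<^sub>i v\<^sup>*\<^sub>j\<close> along edges propagate one scaling factor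
  \<open>t\<close> with \<open>u\<^sub>i = t u\<^sup>*\<^sub>i\<close> and \<open>v\<^sub>j = v\<^sup>*\<^sub>j / t\<close>, and an edge from a zero node into \<open>\<G>\<^sub>1\<close> forces
  the zero to persist. Conversely, one can rescale one side of a cut of \<open>\<G>\<^sub>1\<close>, or perturb \<open>u\<^sup>*\<close> at a
  node of \<open>\<I>\<^sub>0\<^sub>0\<close>, without changing \<open>h\<close>. For the closure, the two conditions survive an enlargement
  of the supports of \<open>C\<close>, \<open>u\<^sup>*\<close>, \<open>v\<^sup>*\<close>, because each node newly entering \<open>\<G>\<^sub>1\<close> is already adjacent
  to an old one; since supports can only grow under small perturbations, the nondegenerate triples
  are relatively open and the degenerate set is closed.
\<close>

section \<open>Connectedness as the absence of a cut\<close>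

text \<open>A predicate preserved along arcs is preserved along paths of the symmetrized graph.
  Conversely, reachability from a fixed node \<open>u\<close> is itself such a predicate, so its
  constancy makes every node reachable from \<open>u\<close>.\<close>

lemma connected_iff_no_cut:
  "graph_connected G \<longleftrightarrow> verts G \<noteq> {} \<and>
     (\<forall>P. (\<forall>x\<in>verts G. \<forall>y\<in>verts G. x \<rightarrow>\<^bsub>G\<^esub> y \<longrightarrow> (P x \<longleftrightarrow> P y)) \<longrightarrow>
          (\<forall>x\<in>verts G. \<forall>y\<in>verts G. P x \<longleftrightarrow> P y))"
  (is "?L \<longleftrightarrow> _ \<and> (\<forall>P. ?inv P \<longrightarrow> ?const P)")
proof -
  have sym_adj: "(x, y) \<in> parcs (mk_symmetric G) \<longleftrightarrow> x \<rightarrow>\<^bsub>G\<^esub> y \<or> y \<rightarrow>\<^bsub>G\<^esub> x" for x y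
    by (auto simp: parcs_mk_symmetric arcs_ends_conv image_iff)
  have "(\<forall>u\<in>verts G. \<forall>v\<in>verts G. u \<rightarrow>\<^sup>*\<^bsub>mk_symmetric G\<^esub> v) \<longleftrightarrow> (\<forall>P. ?inv P \<longrightarrow> ?const P)"
    (is "?R \<longleftrightarrow> _")
  proof (intro iffI allI impI)
    fix P assume R: ?R and inv: "?inv P"
    have "P u \<longleftrightarrow> P v" if "(u, v) \<in> rtrancl_on (verts G) (parcs (mk_symmetric G))" for u v
      using that by induction (use inv sym_adj in blast)+
    then show "?const P" using R by (simp add: reachable_def)
  next
    assume cut: "\<forall>P. ?inv P \<longrightarrow> ?const P"
    show ?R
    proof (intro ballI)
      fix u v assume u: "u \<in> verts G" and v: "v \<in> verts G"
      let ?P = "\<lambda>x. (u, x) \<in> rtrancl_on (verts G) (parcs (mk_symmetric G))"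
      have "?inv ?P" by (auto intro: rtrancl_on_into_rtrancl_on simp: sym_adj)
      then have "?const ?P" using cut[rule_format, of ?P] by blast
      moreover have "?P u" using u by simp
      ultimately have "?P v" using u v by blast
      then show "u \<rightarrow>\<^sup>*\<^bsub>mk_symmetric G\<^esub> v" by (simp add: reachable_def)
    qed
  qed
  then show ?thesis
    by (simp add: connected_def strongly_connected_def)
qed

lemma GG1_adj: "x \<rightarrow>\<^bsub>GG1 C us vs\<^esub> y \<longleftrightarrow>
    x \<rightarrow>\<^bsub>GG C\<^esub> y \<and> x \<in> I1u us \<union> I1v vs \<and> y \<in> I1u us \<union> I1v vs"
  by (auto simp: GG1_def GG_def arcs_ends_def arc_to_ends_def induce_subgraph_def)

text \<open>Bipartite form of the cut criterion: a predicate on nodes becomes a pair on rows and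
  columns, and constancy is measured against the base row \<open>k\<close>, which also witnesses
  that the graph has a node.\<close>

lemma connected_GG1_iff:
  fixes C :: "real ^ 'n ^ 'm"
  assumes "us $ k \<noteq> 0"
  shows "graph_connected (GG1 C us vs) \<longleftrightarrow>
    (\<forall>P Q. (\<forall>i j. us $ i \<noteq> 0 \<longrightarrow> vs $ j \<noteq> 0 \<longrightarrow> C $ i $ j > 0 \<longrightarrow> (P i \<longleftrightarrow> Q j)) \<longrightarrow>
       (\<forall>i. us $ i \<noteq> 0 \<longrightarrow> (P i \<longleftrightarrow> P k)) \<and> (\<forall>j. vs $ j \<noteq> 0 \<longrightarrow> (Q j \<longleftrightarrow> P k)))"
    (is "_ \<longleftrightarrow> (\<forall>P Q. ?inv P Q \<longrightarrow> ?const P Q)")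
proof -
  let ?G = "GG1 C us vs"
  have verts: "verts ?G = I1u us \<union> I1v vs" by (simp add: GG1_def)
  have k: "Inl k \<in> verts ?G" using assms by (auto simp: verts I1u_def)
  have ball_I1: "(\<forall>x\<in>I1u us \<union> I1v vs. R x) \<longleftrightarrow>
      (\<forall>i. us $ i \<noteq> 0 \<longrightarrow> R (Inl i)) \<and> (\<forall>j. vs $ j \<noteq> 0 \<longrightarrow> R (Inr j))" for R
    by (auto simp: I1u_def I1v_def)
  have inv: "(\<forall>x\<in>verts ?G. \<forall>y\<in>verts ?G. x \<rightarrow>\<^bsub>?G\<^esub> y \<longrightarrow> (R x \<longleftrightarrow> R y)) \<longleftrightarrow> ?inv (R \<circ> Inl) (R \<circ> Inr)" for R
    unfolding verts ball_I1 by (auto simp: GG1_adj GG_adj I1u_def I1v_def)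
  have const: "(\<forall>x\<in>verts ?G. \<forall>y\<in>verts ?G. R x \<longleftrightarrow> R y) \<longleftrightarrow> ?const (R \<circ> Inl) (R \<circ> Inr)" for R
  proof
    assume "\<forall>x\<in>verts ?G. \<forall>y\<in>verts ?G. R x \<longleftrightarrow> R y"
    then have "\<forall>x\<in>verts ?G. R x \<longleftrightarrow> R (Inl k)" using k by blast
    then show "?const (R \<circ> Inl) (R \<circ> Inr)" by (auto simp: verts I1u_def I1v_def)
  next
    assume "?const (R \<circ> Inl) (R \<circ> Inr)"
    then have "\<forall>x\<in>verts ?G. R x \<longleftrightarrow> R (Inl k)" by (auto simp: verts I1u_def I1v_def)
    then show "\<forall>x\<in>verts ?G. \<forall>y\<in>verts ?G. R x \<longleftrightarrow> R y" by blast
  qed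
  have "graph_connected ?G \<longleftrightarrow> (\<forall>R. ?inv (R \<circ> Inl) (R \<circ> Inr) \<longrightarrow> ?const (R \<circ> Inl) (R \<circ> Inr))"
    unfolding connected_iff_no_cut inv const using k by blast
  also have "\<dots> \<longleftrightarrow> (\<forall>P Q. ?inv P Q \<longrightarrow> ?const P Q)"
  proof (intro iffI allI)
    fix P :: "'m \<Rightarrow> bool" and Q :: "'n \<Rightarrow> bool"
    assume "\<forall>R. ?inv (R \<circ> Inl) (R \<circ> Inr) \<longrightarrow> ?const (R \<circ> Inl) (R \<circ> Inr)"
    \<comment> \<open>Every pair \<open>P\<close>, \<open>Q\<close> comes from a single predicate on
      the sum type.\<close>
    then have "?inv (case_sum P Q \<circ> Inl) (case_sum P Q \<circ> Inr) \<longrightarrow>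
        ?const (case_sum P Q \<circ> Inl) (case_sum P Q \<circ> Inr)" by (rule spec)
    then show "?inv P Q \<longrightarrow> ?const P Q" unfolding case_sum_o_inj .
  qed blast
  finally show ?thesis .
qed

lemma I00u_empty_iff: "I00u C us vs = {} \<longleftrightarrow> (\<forall>i. us $ i = 0 \<longrightarrow> (\<exists>j. vs $ j \<noteq> 0 \<and> C $ i $ j > 0))"
  unfolding I00u_def I0u_def I1u_def I1v_def by (force simp: GG_adj)

lemma I00v_empty_iff: "I00v C us vs = {} \<longleftrightarrow> (\<forall>j. vs $ j = 0 \<longrightarrow> (\<exists>i. us $ i \<noteq> 0 \<and> C $ i $ j > 0))"
  unfolding I00v_def I0v_def I1u_def I1v_def by (force simp: GG_adj)

definition nondegenerate_graph :: "real ^ 'n ^ 'm \<Rightarrow> real ^ 'm \<Rightarrow> real ^ 'n \<Rightarrow> bool" where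
  "nondegenerate_graph C us vs \<longleftrightarrow>
     graph_connected (GG1 C us vs) \<and> I00u C us vs = {} \<and> I00v C us vs = {}"

lemma l1norm_eq_1_imp_nonzero: "l1norm x = 1 \<Longrightarrow> \<exists>k. x $ k \<noteq> 0"
  by (rule ccontr) (simp add: l1norm_def)

section \<open>Factorizations agreeing on the edges\<close>

text \<open>All summands are nonnegative, so each must vanish; from here on \<open>C\<close> matters
  only through its support.\<close>

lemma h_eq_0_iff:
  assumes "C \<in> S_C"
  shows "h u v C us vs = 0 \<longleftrightarrow> (\<forall>i j. C $ i $ j > 0 \<longrightarrow> u $ i * v $ j = us $ i * vs $ j)"
proof -
  have nn: "0 \<le> C $ i $ j" for i j using assms by (simp add: S_C_def)
  have "h u v C us vs = 0 \<longleftrightarrow> (\<forall>i j. C $ i $ j * (u $ i * v $ j - us $ i * vs $ j)\<^sup>2 = 0)"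
    unfolding h_def using nn by (simp add: sum_nonneg_eq_0_iff sum_nonneg)
  also have "\<dots> \<longleftrightarrow> (\<forall>i j. C $ i $ j > 0 \<longrightarrow> u $ i * v $ j = us $ i * vs $ j)"
    using nn by (force simp: order_less_le)
  finally show ?thesis .
qed

lemma nondegenerate_graph_unique_factorization:
  assumes good: "nondegenerate_graph C us vs" and k: "us $ k \<noteq> 0" and l: "vs $ l \<noteq> 0"
    and eq: "\<And>i j. C $ i $ j > 0 \<Longrightarrow> u $ i * v $ j = us $ i * vs $ j"
  shows "outer u v = outer us vs"
proof -
  define t where "t = u $ k / us $ k"
  \<comment> \<open>These two equations serve as the row and column predicates of the cut criterion.
    The column equation is multiplied out because \<open>t \<noteq> 0\<close> is not known
    yet.\<close>
  have step: "u $ i = t * us $ i \<longleftrightarrow> t * v $ j = vs $ j"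
    if "us $ i \<noteq> 0" "vs $ j \<noteq> 0" "C $ i $ j > 0" for i j
  proof -
    have uv: "u $ i * v $ j = us $ i * vs $ j" and nz: "u $ i \<noteq> 0" "v $ j \<noteq> 0"
      using eq[of i j] that by auto
    show ?thesis
    proof
      assume "u $ i = t * us $ i"
      then show "t * v $ j = vs $ j" using uv that by (simp add: ac_simps)
    next
      assume "t * v $ j = vs $ j"
      then have "u $ i * v $ j = t * us $ i * v $ j" using uv by (simp add: ac_simps)
      then show "u $ i = t * us $ i" using nz by simp
    qed
  qed
  have "graph_connected (GG1 C us vs)" using good by (simp add: nondegenerate_graph_def)
  note this[unfolded connected_GG1_iff[where us = us and k = k, OF k], THEN spec, THEN spec,
      of "\<lambda>i. u $ i = t * us $ i" "\<lambda>j. t * v $ j = vs $ j"]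
  moreover have "u $ k = t * us $ k" using k by (simp add: t_def)
  ultimately have u1: "us $ i \<noteq> 0 \<Longrightarrow> u $ i = t * us $ i"
    and v1: "vs $ j \<noteq> 0 \<Longrightarrow> t * v $ j = vs $ j" for i j
    using step by blast+
  \<comment> \<open>With \<open>t = 0\<close> the column equation at \<open>l\<close> would force
    \<open>vs $ l = 0\<close>.\<close>
  have t: "t \<noteq> 0" using v1[OF l] l by auto
  have u: "u $ i = t * us $ i" for i
  proof (cases "us $ i = 0")
    case True
    then obtain j where j: "vs $ j \<noteq> 0" "C $ i $ j > 0"
      using good by (auto simp: nondegenerate_graph_def I00u_empty_iff)
    then have "v $ j \<noteq> 0" using v1[of j] by auto
    then show ?thesis using eq[OF j(2)] True by simp
  qed (rule u1)
  have v: "t * v $ j = vs $ j" for j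
  proof (cases "vs $ j = 0")
    case True
    then obtain i where i: "us $ i \<noteq> 0" "C $ i $ j > 0"
      using good by (auto simp: nondegenerate_graph_def I00v_empty_iff)
    then show ?thesis using eq[OF i(2)] True u[of i] t by simp
  qed (rule v1)
  have "u $ i * v $ j = us $ i * vs $ j" for i j
    unfolding u[of i] v[of j, symmetric] by (simp only: ac_simps)
  then show ?thesis by (simp add: outer_def vec_eq_iff)
qed

lemma degenerate_graph_other_factorization:
  assumes bad: "\<not> nondegenerate_graph C us vs" and k: "us $ k \<noteq> 0" and l: "vs $ l \<noteq> 0"
  obtains u v where "\<And>i j. C $ i $ j > 0 \<Longrightarrow> u $ i * v $ j = us $ i * vs $ j"
    and "outer u v \<noteq> outer us vs"
proof -
  consider "\<not> graph_connected (GG1 C us vs)" | "I00u C us vs \<noteq> {}" | "I00v C us vs \<noteq> {}"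
    using bad by (auto simp: nondegenerate_graph_def)
  then show thesis
  proof cases
    case 1
    then obtain P Q where
      inv: "\<And>i j. \<lbrakk>us $ i \<noteq> 0; vs $ j \<noteq> 0; C $ i $ j > 0\<rbrakk> \<Longrightarrow> P i \<longleftrightarrow> Q j"
      and nc: "\<not> ((\<forall>i. us $ i \<noteq> 0 \<longrightarrow> (P i \<longleftrightarrow> P k)) \<and> (\<forall>j. vs $ j \<noteq> 0 \<longrightarrow> (Q j \<longleftrightarrow> P k)))"
      unfolding connected_GG1_iff[where us = us and k = k, OF k] by blast
    \<comment> \<open>Doubling on \<open>P\<close> and halving on \<open>Q\<close> cancel wherever
      the two agree, hence on every edge of the graph \<open>GG1\<close>; on the other edges both
      products are zero.\<close>
    define u v where "u = (\<chi> i. (if P i then 2 else 1) * us $ i)"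
      and "v = (\<chi> j. vs $ j / (if Q j then 2 else 1))"
    \<comment> \<open>If the cut separates two rows, column \<open>l\<close> disagrees with one of
      them; otherwise it separates row \<open>k\<close> from some column.\<close>
    have "\<exists>i j. us $ i \<noteq> 0 \<and> vs $ j \<noteq> 0 \<and> P i \<noteq> Q j"
      using nc k l by metis
    then obtain i j where ij: "us $ i \<noteq> 0" "vs $ j \<noteq> 0" "P i \<noteq> Q j" by blast
    have "u $ i * v $ j \<noteq> us $ i * vs $ j" using ij by (auto simp: u_def v_def)
    then have ne: "outer u v \<noteq> outer us vs" by (auto simp: outer_def vec_eq_iff)
    have "u $ i * v $ j = us $ i * vs $ j" if "C $ i $ j > 0" for i j
      using inv[OF _ _ that] by (auto simp: u_def v_def)
    with ne show thesis using that by blast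
  next
    case 2
    then obtain i where i: "us $ i = 0" and iso: "\<And>j. C $ i $ j > 0 \<Longrightarrow> vs $ j = 0"
      by (auto simp: I00u_empty_iff)
    \<comment> \<open>All edges at \<open>i\<close> lead to zeros of \<open>vs\<close>, so raising
      entry \<open>i\<close> of \<open>us\<close> is invisible on edges, yet it changes the outer
      product at \<open>(i, l)\<close>.\<close>
    have "C $ i' $ j > 0 \<Longrightarrow> (us + axis i 1) $ i' * vs $ j = us $ i' * vs $ j" for i' j
      using iso[of j] by (auto simp: axis_def)
    moreover have "(us + axis i 1) $ i * vs $ l \<noteq> us $ i * vs $ l" using i l by simp
    then have "outer (us + axis i 1) vs \<noteq> outer us vs" unfolding outer_def vec_eq_iff vec_lambda_beta by blast
    ultimately show thesis using that by blast
  next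
    case 3
    then obtain j where j: "vs $ j = 0" and iso: "\<And>i. C $ i $ j > 0 \<Longrightarrow> us $ i = 0"
      by (auto simp: I00v_empty_iff)
    have "C $ i $ j' > 0 \<Longrightarrow> us $ i * (vs + axis j 1) $ j' = us $ i * vs $ j'" for i j'
      using iso[of i] by (auto simp: axis_def)
    moreover have "us $ k * (vs + axis j 1) $ j \<noteq> us $ k * vs $ j" using j k by simp
    then have "outer us (vs + axis j 1) \<noteq> outer us vs" unfolding outer_def vec_eq_iff vec_lambda_beta by blast
    ultimately show thesis using that by blast
  qed
qed

text \<open>The norm conditions supply the nonzero entries \<open>k\<close> and \<open>l\<close> on
  which both directions rely.\<close>

lemma D_asym_iff:
  "(C, us, vs) \<in> D_asym \<longleftrightarrow>
     C \<in> S_C \<and> l1norm us = 1 \<and> l1norm vs = 1 \<and> \<not> nondegenerate_graph C us vs"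
proof (cases "C \<in> S_C \<and> l1norm us = 1 \<and> l1norm vs = 1")
  case True
  then obtain k l where kl: "us $ k \<noteq> 0" "vs $ l \<noteq> 0" and C: "C \<in> S_C"
    using l1norm_eq_1_imp_nonzero by metis
  have "(C, us, vs) \<in> D_asym \<longleftrightarrow>
      (\<exists>u v. (\<forall>i j. C $ i $ j > 0 \<longrightarrow> u $ i * v $ j = us $ i * vs $ j) \<and> outer u v \<noteq> outer us vs)"
    using True by (simp add: D_asym_def h_eq_0_iff)
  also have "\<dots> \<longleftrightarrow> \<not> nondegenerate_graph C us vs"
    using nondegenerate_graph_unique_factorization[OF _ kl]
      degenerate_graph_other_factorization[OF _ kl] by metis
  finally show ?thesis using True by simp
qed (auto simp: D_asym_def)

section \<open>Growing supports and closedness\<close>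

lemma nondegenerate_graph_mono:
  assumes good: "nondegenerate_graph C us vs" and k: "us $ k \<noteq> 0"
    and C: "\<And>i j. C $ i $ j > 0 \<Longrightarrow> C' $ i $ j > 0"
    and us: "\<And>i. us $ i \<noteq> 0 \<Longrightarrow> us' $ i \<noteq> 0"
    and vs: "\<And>j. vs $ j \<noteq> 0 \<Longrightarrow> vs' $ j \<noteq> 0"
  shows "nondegenerate_graph C' us' vs'"
proof -
  have Iu: "\<exists>j. vs $ j \<noteq> 0 \<and> C $ i $ j > 0" if "us $ i = 0" for i
    using good that by (simp add: nondegenerate_graph_def I00u_empty_iff)
  have Iv: "\<exists>i. us $ i \<noteq> 0 \<and> C $ i $ j > 0" if "vs $ j = 0" for j
    using good that by (simp add: nondegenerate_graph_def I00v_empty_iff)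
  have conn: "graph_connected (GG1 C us vs)" using good by (simp add: nondegenerate_graph_def)
  have "(\<forall>i. us' $ i \<noteq> 0 \<longrightarrow> (P i \<longleftrightarrow> P k)) \<and> (\<forall>j. vs' $ j \<noteq> 0 \<longrightarrow> (Q j \<longleftrightarrow> P k))"
    if inv: "\<forall>i j. us' $ i \<noteq> 0 \<longrightarrow> vs' $ j \<noteq> 0 \<longrightarrow> C' $ i $ j > 0 \<longrightarrow> (P i \<longleftrightarrow> Q j)" for P Q
  proof -
    have "\<forall>i j. us $ i \<noteq> 0 \<longrightarrow> vs $ j \<noteq> 0 \<longrightarrow> C $ i $ j > 0 \<longrightarrow> (P i \<longleftrightarrow> Q j)"
      using inv C us vs by blast
    then have P: "us $ i \<noteq> 0 \<Longrightarrow> P i \<longleftrightarrow> P k" and Q: "vs $ j \<noteq> 0 \<Longrightarrow> Q j \<longleftrightarrow> P k" for i j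
      using conn unfolding connected_GG1_iff[where us = us and k = k, OF k] by blast+
    \<comment> \<open>A row that is new in the support has, by \<open>Iu\<close>, an old column as
      neighbour, where \<open>Q\<close> already agrees with \<open>P k\<close>.\<close>
    have "P i \<longleftrightarrow> P k" if "us' $ i \<noteq> 0" for i
      using P Q Iu[of i] inv that C vs by metis
    moreover have "Q j \<longleftrightarrow> P k" if "vs' $ j \<noteq> 0" for j
      using P Q Iv[of j] inv that C us by metis
    ultimately show ?thesis by blast
  qed
  then have "graph_connected (GG1 C' us' vs')"
    unfolding connected_GG1_iff[where us = us' and k = k, OF us[OF k]] by blast
  \<comment> \<open>Zeros of \<open>us'\<close> and \<open>vs'\<close> are zeros of
    \<open>us\<close> and \<open>vs\<close>, and their old neighbours remain neighbours with nonzero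
    value.\<close>
  moreover have "I00u C' us' vs' = {}" "I00v C' us' vs' = {}"
    unfolding I00u_empty_iff I00v_empty_iff using Iu Iv C us vs by metis+
  ultimately show ?thesis by (simp add: nondegenerate_graph_def)
qed

lemma closed_S_C: "closed S_C"
  unfolding S_C_def
  by (intro closed_Collect_conj closed_Collect_all closed_Collect_le closed_Collect_eq continuous_intros)

lemma closed_l1norm_sphere: "closed {x. l1norm x = r}"
  unfolding l1norm_def by (intro closed_Collect_eq continuous_intros)

text \<open>Taking the closure therefore adds nothing, and the closure claim reduces to the
  membership criterion \<open>D_asym_iff\<close>.\<close>

lemma closed_D_asym: "closed (D_asym :: ((real ^ 'n ^ 'm) \<times> (real ^ 'm) \<times> (real ^ 'n)) set)"
  unfolding closed_sequential_limits
proof (intro allI impI, elim conjE)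
  fix X :: "nat \<Rightarrow> (real ^ 'n ^ 'm) \<times> (real ^ 'm) \<times> (real ^ 'n)" and p
  assume X: "\<forall>n. X n \<in> D_asym" and lim: "X \<longlonglongrightarrow> p"
  obtain C us vs where p: "p = (C, us, vs)" by (cases p)
  define C' us' vs' where "C' n = fst (X n)" and "us' n = fst (snd (X n))"
    and "vs' n = snd (snd (X n))" for n
  have D: "(C' n, us' n, vs' n) \<in> D_asym" for n
    using X by (simp add: C'_def us'_def vs'_def)
  have limC: "C' \<longlonglongrightarrow> C" and limu: "us' \<longlonglongrightarrow> us" and limv: "vs' \<longlonglongrightarrow> vs"
    using tendsto_fst[OF lim] tendsto_fst[OF tendsto_snd[OF lim]] tendsto_snd[OF tendsto_snd[OF lim]]
    by (simp_all add: p C'_def[abs_def] us'_def[abs_def] vs'_def[abs_def])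
  have C: "C \<in> S_C"
    using closed_sequentially[OF closed_S_C _ limC] D by (simp add: D_asym_iff)
  have us: "l1norm us = 1" and vs: "l1norm vs = 1"
    using closed_sequentially[OF closed_l1norm_sphere _ limu, of 1]
      closed_sequentially[OF closed_l1norm_sphere _ limv, of 1] D by (simp_all add: D_asym_iff)
  obtain k where k: "us $ k \<noteq> 0" using l1norm_eq_1_imp_nonzero[OF us] by blast
  have "\<forall>\<^sub>F n in sequentially. C $ i $ j > 0 \<longrightarrow> C' n $ i $ j > 0" for i j
    using order_tendstoD(1)[OF tendsto_vec_nth[OF tendsto_vec_nth[OF limC]], of 0 i j]
    by (cases "C $ i $ j > 0") auto
  moreover have "\<forall>\<^sub>F n in sequentially. us $ i \<noteq> 0 \<longrightarrow> us' n $ i \<noteq> 0" for i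
    using tendsto_imp_eventually_ne[OF tendsto_vec_nth[OF limu], of i 0] by (cases "us $ i = 0") auto
  moreover have "\<forall>\<^sub>F n in sequentially. vs $ j \<noteq> 0 \<longrightarrow> vs' n $ j \<noteq> 0" for j
    using tendsto_imp_eventually_ne[OF tendsto_vec_nth[OF limv], of j 0] by (cases "vs $ j = 0") auto
  \<comment> \<open>Finiteness of the index types gives one threshold valid for all entries at
    once.\<close>
  ultimately have "\<forall>\<^sub>F n in sequentially. (\<forall>i j. C $ i $ j > 0 \<longrightarrow> C' n $ i $ j > 0) \<and>
      (\<forall>i. us $ i \<noteq> 0 \<longrightarrow> us' n $ i \<noteq> 0) \<and> (\<forall>j. vs $ j \<noteq> 0 \<longrightarrow> vs' n $ j \<noteq> 0)"
    by (intro eventually_conj eventually_all_finite)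
  then obtain n where n: "\<forall>i j. C $ i $ j > 0 \<longrightarrow> C' n $ i $ j > 0"
      "\<forall>i. us $ i \<noteq> 0 \<longrightarrow> us' n $ i \<noteq> 0" "\<forall>j. vs $ j \<noteq> 0 \<longrightarrow> vs' n $ j \<noteq> 0"
    by (auto simp: eventually_sequentially)
  \<comment> \<open>Otherwise monotonicity would make the \<open>n\<close>-th term nondegenerate,
    although it lies in \<open>D_asym\<close>.\<close>
  have "\<not> nondegenerate_graph C us vs"
    using nondegenerate_graph_mono[OF _ k, of C vs "C' n" "us' n" "vs' n"] n D[of n]
    by (auto simp: D_asym_iff)
  then show "p \<in> D_asym" using C us vs by (simp add: p D_asym_iff)
qed

theorem theoremE2:
  shows "(\<forall>(C :: real ^ 'n ^ 'm) us vs. C \<in> S_C \<and> l1norm us = 1 \<and> l1norm vs = 1 \<longrightarrow>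
            ((C, us, vs) \<notin> D_asym \<longleftrightarrow>
               graph_connected (GG1 C us vs) \<and> (I00u C us vs = {} \<and> I00v C us vs = {})))
       \<and> closure D_asym =
           {(C :: real ^ 'n ^ 'm, us, vs). C \<in> S_C \<and> l1norm us = 1 \<and> l1norm vs = 1 \<and>
              (\<not> graph_connected (GG1 C us vs) \<or> I00u C us vs \<noteq> {} \<or> I00v C us vs \<noteq> {})}"
  unfolding closure_closed[OF closed_D_asym] by (auto simp: D_asym_iff nondegenerate_graph_def)

end
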